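(* Let $f:\mathbb{R}^d\to\mathbb{R}$ and $\hat f:\mathbb{R}^d\to\mathbb{R}$ be differentiable, let $\theta\in\mathbb{R}^d$, let $\mathbf v=(v_1,\dots,v_d)$ be a random vector in $\mathbb{R}^d$, and let $h_{\mathbf v}(\theta)$ be the control variate forward gradient of $f$ with surrogate $\hat f$. If $v_1,\dots,v_d$ are independent and have zero mean and unit variance, then $h_{\mathbf v}(\theta)$ is an unbiased estimator of $\nabla f(\theta)$, i.e. $$\mathbb{E}[h_{\mathbf v}(\theta)]=\nabla f(\theta).$$ Furthermore, if $v_1,\dots,v_d$ are independent Rademacher variables, then the mean squared deviation $\mathbb{E}[\|h_{\mathbf v}(\theta)-\nabla f(\theta)\|^2]$ is minimized (among all choices of independent $v_1,\dots,v_d$ with zero mean and unit variance) and is equal to $$\mathbb{E}[\|h_{\mathbf v}(\theta)-\nabla f(\theta)\|^2]=(d-1)\,\|\nabla f(\theta)-\nabla\hat f(\theta)\|^2.$$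
   Context: For differentiable $f,\hat f:\mathbb{R}^d\to\mathbb{R}$ and a random vector $\mathbf v\in\mathbb{R}^d$, define the forward gradients $g_{\mathbf v}(\theta)=(\nabla f(\theta)\cdot\mathbf v)\,\mathbf v$ and $\hat g_{\mathbf v}(\theta)=(\nabla\hat f(\theta)\cdot\mathbf v)\,\mathbf v$. The control variate forward gradient is $h_{\mathbf v}(\theta)=g_{\mathbf v}(\theta)-\hat g_{\mathbf v}(\theta)+\mathbb{E}_{\mathbf v}[\hat g_{\mathbf v}(\theta)]$. A Rademacher variable takes the values $1$ and $-1$ each with probability $1/2$. $\|\cdot\|$ is the Euclidean norm. The mean squared deviation is allowed to take the value $+\infty$. *)

theory Defs
  imports "HOL-Probability.Probability"
begin

definition grad :: "('e::euclidean_space \<Rightarrow> real) \<Rightarrow> 'e \<Rightarrow> 'e" where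
  "grad f x = (THE D. GDERIV f x :> D)"

lemma GDERIV_grad:
  fixes f :: "'e::euclidean_space \<Rightarrow> real"
  assumes "f differentiable (at x)"
  shows "GDERIV f x :> grad f x"
proof -
  obtain f' where f': "(f has_derivative f') (at x)"
    using assms by (auto simp: differentiable_def)
  interpret linear f'
    using f' by (rule has_derivative_linear)
  define D where "D = (\<Sum>b\<in>Basis. f' b *\<^sub>R b)"
  have "f' = (\<lambda>h. inner h D)"
  proof
    fix h
    have "f' h = f' (\<Sum>b\<in>Basis. inner h b *\<^sub>R b)"
      by (simp add: euclidean_representation)
    also have "\<dots> = inner h D"
      by (simp add: D_def sum scale inner_sum_right mult.commute)
    finally show "f' h = inner h D" .
  qed
  with f' have D: "GDERIV f x :> D"
    by (simp add: gderiv_def)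
  show ?thesis
    unfolding grad_def
  proof (rule theI[of "\<lambda>D. GDERIV f x :> D", OF D])
    fix D' assume "GDERIV f x :> D'"
    then have "(\<lambda>h. inner h D') = (\<lambda>h. inner h D)"
      using D unfolding gderiv_def by (rule has_derivative_unique)
    then show "D' = D"
      by (metis vector_eq_ldot)
  qed
qed

definition forward_gradient :: "('e::euclidean_space \<Rightarrow> real) \<Rightarrow> 'e \<Rightarrow> 'e \<Rightarrow> 'e" where
  "forward_gradient f \<theta> v = (grad f \<theta> \<bullet> v) *\<^sub>R v"

text \<open>
  The random direction is a random variable \<open>v\<close> on \<open>M\<close>; the last summand is a constant, the
  expectation of the surrogate's forward gradient under the law of this same \<open>v\<close>.
\<close>

definition cv_forward_gradient ::
    "'a measure \<Rightarrow> ('a \<Rightarrow> 'e::euclidean_space) \<Rightarrow> ('e \<Rightarrow> real) \<Rightarrow> ('e \<Rightarrow> real) \<Rightarrow> 'e \<Rightarrow> 'a \<Rightarrow> 'e" where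
  "cv_forward_gradient M v f fhat \<theta> \<omega> =
     forward_gradient f \<theta> (v \<omega>) - forward_gradient fhat \<theta> (v \<omega>)
       + (\<integral>\<omega>'. forward_gradient fhat \<theta> (v \<omega>') \<partial>M)"

text \<open>An extended nonnegative integral, so that the value \<open>\<infinity>\<close> is possible.\<close>

definition mean_squared_deviation ::
    "'a measure \<Rightarrow> ('a \<Rightarrow> 'e::euclidean_space) \<Rightarrow> 'e \<Rightarrow> ennreal" where
  "mean_squared_deviation M X c = (\<integral>\<^sup>+\<omega>. ennreal ((norm (X \<omega> - c))\<^sup>2) \<partial>M)"

definition indep_components :: "'a measure \<Rightarrow> ('a \<Rightarrow> real^'n) \<Rightarrow> bool" where
  "indep_components M v \<longleftrightarrow>
     prob_space.indep_vars M (\<lambda>_. borel) (\<lambda>i \<omega>. v \<omega> $ i) UNIV"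

text \<open>
  Integrability is required explicitly because a Bochner integral that does not exist equals 0.
\<close>

definition zero_mean_unit_variance :: "'a measure \<Rightarrow> ('a \<Rightarrow> real) \<Rightarrow> bool" where
  "zero_mean_unit_variance M X \<longleftrightarrow>
     integrable M X \<and> integrable M (\<lambda>\<omega>. (X \<omega>)\<^sup>2) \<and>
     prob_space.expectation M X = 0 \<and> prob_space.variance M X = 1"

definition rademacher :: "'a measure \<Rightarrow> ('a \<Rightarrow> real) \<Rightarrow> bool" where
  "rademacher M X \<longleftrightarrow>
     X \<in> borel_measurable M \<and>
     measure M {\<omega> \<in> space M. X \<omega> = 1} = 1/2 \<and>
     measure M {\<omega> \<in> space M. X \<omega> = - 1} = 1/2"

text \<open>
  The random vectors over which the mean squared deviation is minimized.
\<close>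

definition admissible :: "'a measure \<Rightarrow> ('a \<Rightarrow> real^'n) \<Rightarrow> bool" where
  "admissible M v \<longleftrightarrow>
     v \<in> borel_measurable M \<and> indep_components M v \<and>
     (\<forall>i. zero_mean_unit_variance M (\<lambda>\<omega>. v \<omega> $ i))"

end

theory Submission
  imports Defs
begin

text \<open>
  Put \<open>c = \<nabla>f(\<theta>) - \<nabla>fhat(\<theta>)\<close>. Since \<open>E[v\<^sub>i v\<^sub>j]\<close> is the Kronecker delta, every forward
  gradient is unbiased, and the deviation is \<open>h - \<nabla>f(\<theta>) = (c \<bullet> v) v - c\<close>. Its \<open>k\<close>-th
  component is \<open>c\<^sub>k (v\<^sub>k\<^sup>2 - 1) + v\<^sub>k S\<close>, where \<open>S = \<Sum>j\<noteq>k. c\<^sub>j v\<^sub>j\<close> is centred and independent of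
  \<open>v\<^sub>k\<close>. Averaging the square over \<open>S\<close> first kills the cross term, and since all integrands are
  nonnegative this needs no fourth moments: the mean square of the component is
  \<open>c\<^sub>k\<^sup>2 E[(v\<^sub>k\<^sup>2 - 1)\<^sup>2] + (\<Sum>j\<noteq>k. c\<^sub>j\<^sup>2)\<close>. The first term is nonnegative and vanishes in the
  Rademacher case, and the second terms sum to \<open>(d - 1) \<parallel>c\<parallel>\<^sup>2\<close>.
\<close>

lemma (in prob_space) nn_integral_square_centred_indep:
  fixes X S :: "'a \<Rightarrow> real" and a :: real
  assumes indep: "indep_var borel X borel S"
    and X2: "integrable M (\<lambda>\<omega>. (X \<omega>)\<^sup>2)" "expectation (\<lambda>\<omega>. (X \<omega>)\<^sup>2) = 1"
    and S: "integrable M S" "expectation S = 0"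
    and S2: "integrable M (\<lambda>\<omega>. (S \<omega>)\<^sup>2)"
  shows "(\<integral>\<^sup>+\<omega>. ennreal ((a * ((X \<omega>)\<^sup>2 - 1) + X \<omega> * S \<omega>)\<^sup>2) \<partial>M) =
    (\<integral>\<^sup>+\<omega>. ennreal (a\<^sup>2 * ((X \<omega>)\<^sup>2 - 1)\<^sup>2) \<partial>M) + ennreal (expectation (\<lambda>\<omega>. (S \<omega>)\<^sup>2))"
proof -
  define s2 where "s2 = expectation (\<lambda>\<omega>. (S \<omega>)\<^sup>2)"
  have s2: "s2 \<ge> 0" by (simp add: s2_def)
  have [measurable]: "X \<in> borel_measurable M" "S \<in> borel_measurable M"
    using indep by (auto dest: indep_var_rv1 indep_var_rv2)
  interpret PS: prob_space "distr M borel S" by (rule prob_space_distr) simp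
  have prod: "distr M borel X \<Otimes>\<^sub>M distr M borel S = distr M (borel \<Otimes>\<^sub>M borel) (\<lambda>\<omega>. (X \<omega>, S \<omega>))"
    using indep by (simp add: indep_var_distribution_eq)
  \<comment> \<open>With the value of \<open>X\<close> frozen at \<open>x\<close>, the integrand is
    a quadratic polynomial in \<open>S\<close> and has finite mean. Passing to the Bochner integral
    is therefore legitimate here, and the linear term drops because \<open>S\<close> is
    centred.\<close>
  have inner: "(\<integral>\<^sup>+\<omega>. ennreal ((b + x * S \<omega>)\<^sup>2) \<partial>M) = ennreal (b\<^sup>2) + ennreal (x\<^sup>2 * s2)"
    for b x :: real
  proof -
    have eq: "(b + x * S \<omega>)\<^sup>2 = b\<^sup>2 + 2 * b * x * S \<omega> + x\<^sup>2 * (S \<omega>)\<^sup>2" for \<omega>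
      by (simp add: power2_eq_square algebra_simps)
    have int: "integrable M (\<lambda>\<omega>. (b + x * S \<omega>)\<^sup>2)"
      unfolding eq using S S2 by simp
    have "(\<integral>\<^sup>+\<omega>. ennreal ((b + x * S \<omega>)\<^sup>2) \<partial>M) = ennreal (expectation (\<lambda>\<omega>. (b + x * S \<omega>)\<^sup>2))"
      by (rule nn_integral_eq_integral[OF int]) simp
    also have "expectation (\<lambda>\<omega>. (b + x * S \<omega>)\<^sup>2) = b\<^sup>2 + x\<^sup>2 * s2"
      unfolding eq using S S2 by (simp add: s2_def prob_space)
    finally show ?thesis using s2 by simp
  qed
  \<comment> \<open>By independence the joint law is a product, so Tonelli lets \<open>S\<close> be
    integrated first. The outer integral over \<open>X\<close> stays extended nonnegative and may be
    infinite.\<close>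
  have "(\<integral>\<^sup>+\<omega>. ennreal ((a * ((X \<omega>)\<^sup>2 - 1) + X \<omega> * S \<omega>)\<^sup>2) \<partial>M) =
      (\<integral>\<^sup>+p. ennreal ((a * ((fst p)\<^sup>2 - 1) + fst p * snd p)\<^sup>2)
        \<partial>distr M (borel \<Otimes>\<^sub>M borel) (\<lambda>\<omega>. (X \<omega>, S \<omega>)))"
    by (subst nn_integral_distr) simp_all
  also have "\<dots> = (\<integral>\<^sup>+x. \<integral>\<^sup>+s. ennreal ((a * (x\<^sup>2 - 1) + x * s)\<^sup>2)
      \<partial>distr M borel S \<partial>distr M borel X)"
    unfolding prod[symmetric] by (subst PS.nn_integral_fst[symmetric]) simp_all
  also have "\<dots> = (\<integral>\<^sup>+\<omega>. \<integral>\<^sup>+\<omega>'. ennreal ((a * ((X \<omega>)\<^sup>2 - 1) + X \<omega> * S \<omega>')\<^sup>2) \<partial>M \<partial>M)"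
    by (simp add: nn_integral_distr)
  also have "\<dots> = (\<integral>\<^sup>+\<omega>. ennreal (a\<^sup>2 * ((X \<omega>)\<^sup>2 - 1)\<^sup>2) + ennreal ((X \<omega>)\<^sup>2 * s2) \<partial>M)"
    by (simp add: inner power_mult_distrib)
  also have "\<dots> = (\<integral>\<^sup>+\<omega>. ennreal (a\<^sup>2 * ((X \<omega>)\<^sup>2 - 1)\<^sup>2) \<partial>M) + (\<integral>\<^sup>+\<omega>. ennreal ((X \<omega>)\<^sup>2 * s2) \<partial>M)"
    by (rule nn_integral_add) simp_all
  also have "(\<integral>\<^sup>+\<omega>. ennreal ((X \<omega>)\<^sup>2 * s2) \<partial>M) = ennreal (expectation (\<lambda>\<omega>. (X \<omega>)\<^sup>2 * s2))"
    by (rule nn_integral_eq_integral) (use X2 s2 in simp_all)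
  finally show ?thesis using X2 by (simp add: s2_def)
qed

text \<open>With mean 0, the variance is the raw second moment.\<close>

lemma zero_mean_unit_variance_square:
  assumes "zero_mean_unit_variance M X"
  shows "integrable M (\<lambda>\<omega>. (X \<omega>)\<^sup>2)" "(\<integral>\<omega>. (X \<omega>)\<^sup>2 \<partial>M) = 1"
  using assms by (auto simp: zero_mean_unit_variance_def)

lemma (in prob_space) admissible_second_moment:
  fixes v :: "'a \<Rightarrow> real^'n"
  assumes "admissible M v"
  shows "integrable M (\<lambda>\<omega>. v \<omega> $ i * v \<omega> $ j)"
    and "expectation (\<lambda>\<omega>. v \<omega> $ i * v \<omega> $ j) = (if i = j then 1 else 0)"
proof -
  have zmuv: "zero_mean_unit_variance M (\<lambda>\<omega>. v \<omega> $ i)" for i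
    using assms by (simp add: admissible_def)
  have iv: "indep_vars (\<lambda>_. borel) (\<lambda>i \<omega>. v \<omega> $ i) UNIV"
    using assms by (simp add: admissible_def indep_components_def)
  have "integrable M (\<lambda>\<omega>. v \<omega> $ i * v \<omega> $ j) \<and>
    expectation (\<lambda>\<omega>. v \<omega> $ i * v \<omega> $ j) = (if i = j then 1 else 0)"
  proof (cases "i = j")
    case True
    then show ?thesis
      using zero_mean_unit_variance_square[OF zmuv[of j]] by (simp add: power2_eq_square)
  next
    case False
    \<comment> \<open>Independence of one variable from a sum of others, used with the one-term sum
      over \<open>{j}\<close>, gives pairwise independence. The mixed moment then factors into a
      product of zero means.\<close>
    have ind: "indep_var borel (\<lambda>\<omega>. v \<omega> $ i) borel (\<lambda>\<omega>. v \<omega> $ j)"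
      using False indep_vars_sum[of "{j}" i, OF _ _ indep_vars_subset[OF iv]] by simp
    show ?thesis
      using False zmuv[of i] zmuv[of j]
      by (auto simp: zero_mean_unit_variance_def
          indep_var_integrable[OF ind] indep_var_lebesgue_integral[OF ind])
  qed
  then show "integrable M (\<lambda>\<omega>. v \<omega> $ i * v \<omega> $ j)"
    "expectation (\<lambda>\<omega>. v \<omega> $ i * v \<omega> $ j) = (if i = j then 1 else 0)"
    by auto
qed

lemma (in prob_space) forward_gradient_unbiased:
  fixes v :: "'a \<Rightarrow> real^'n"
  assumes "admissible M v"
  shows "integrable M (\<lambda>\<omega>. forward_gradient f \<theta> (v \<omega>))"
    and "expectation (\<lambda>\<omega>. forward_gradient f \<theta> (v \<omega>)) = grad f \<theta>"
proof -
  note m = admissible_second_moment[OF assms]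
  \<comment> \<open>Expanding along the fixed vectors \<open>axis j 1\<close> leaves only scalar
    products \<open>v_i v_j\<close> random, so the second moments settle both integrability and the
    mean.\<close>
  have eq: "forward_gradient f \<theta> (v \<omega>) =
      (\<Sum>j\<in>UNIV. (\<Sum>i\<in>UNIV. grad f \<theta> $ i * (v \<omega> $ i * v \<omega> $ j)) *\<^sub>R axis j 1)" for \<omega>
    by (simp add: vec_eq_iff forward_gradient_def inner_vec_def axis_def sum_distrib_left
        sum_distrib_right mult.assoc mult.left_commute if_distrib cong: if_cong)
  show "integrable M (\<lambda>\<omega>. forward_gradient f \<theta> (v \<omega>))"
    unfolding eq by (intro Bochner_Integration.integrable_sum integrable_scaleR_left
        integrable_mult_right m)
  have "expectation (\<lambda>\<omega>. forward_gradient f \<theta> (v \<omega>)) =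
      (\<Sum>j\<in>UNIV. (\<Sum>i\<in>UNIV. grad f \<theta> $ i * (if i = j then 1 else 0)) *\<^sub>R axis j 1)"
    unfolding eq
    by (subst Bochner_Integration.integral_sum)
       (auto simp: m)
  also have "\<dots> = grad f \<theta>"
    by (simp add: vec_eq_iff axis_def if_distrib cong: if_cong)
  finally show "expectation (\<lambda>\<omega>. forward_gradient f \<theta> (v \<omega>)) = grad f \<theta>" .
qed

text \<open>The added constant restores exactly the mean that subtracting the surrogate's forward
  gradient removes.\<close>

lemma (in prob_space) cv_forward_gradient_unbiased:
  fixes v :: "'a \<Rightarrow> real^'n"
  assumes "admissible M v"
  shows "integrable M (cv_forward_gradient M v f fhat \<theta>)"
    and "expectation (cv_forward_gradient M v f fhat \<theta>) = grad f \<theta>"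
  using forward_gradient_unbiased[OF assms]
  by (simp_all add: cv_forward_gradient_def[abs_def] prob_space)

lemma (in prob_space) nn_integral_deviation_component:
  fixes v :: "'a \<Rightarrow> real^'n" and c :: "real^'n"
  assumes adm: "admissible M v"
  shows "(\<integral>\<^sup>+\<omega>. ennreal (((c \<bullet> v \<omega>) * v \<omega> $ k - c $ k)\<^sup>2) \<partial>M) =
    (\<integral>\<^sup>+\<omega>. ennreal ((c $ k)\<^sup>2 * ((v \<omega> $ k)\<^sup>2 - 1)\<^sup>2) \<partial>M) + ennreal (\<Sum>j\<in>-{k}. (c $ j)\<^sup>2)"
proof -
  note m = admissible_second_moment[OF adm]
  have zmuv: "zero_mean_unit_variance M (\<lambda>\<omega>. v \<omega> $ i)" for i
    using adm by (simp add: admissible_def)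
  have iv: "indep_vars (\<lambda>_. borel) (\<lambda>i \<omega>. v \<omega> $ i) UNIV"
    using adm by (simp add: admissible_def indep_components_def)
  define S where "S = (\<lambda>\<omega>. \<Sum>j\<in>-{k}. c $ j * v \<omega> $ j)"
  \<comment> \<open>The weight at \<open>k\<close> is 1 instead of \<open>c $ k\<close>, so that
    \<open>S\<close> comes out independent of \<open>v_k\<close> itself; for
    \<open>c $ k = 0\<close> a scaled coordinate would carry no information.\<close>
  have "indep_vars (\<lambda>_. borel) (\<lambda>i \<omega>. (if i = k then 1 else c $ i) * v \<omega> $ i) UNIV"
    by (rule indep_vars_compose2[OF iv]) simp
  from indep_vars_sum[OF _ _ indep_vars_subset[OF this], where I = "-{k}" and i = k]
  have ind: "indep_var borel (\<lambda>\<omega>. v \<omega> $ k) borel S"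
    by (simp add: S_def)
  have S: "integrable M S" "expectation S = 0"
    using zmuv by (simp_all add: S_def zero_mean_unit_variance_def)
  have S2_eq: "(S \<omega>)\<^sup>2 = (\<Sum>i\<in>-{k}. \<Sum>j\<in>-{k}. c $ i * c $ j * (v \<omega> $ i * v \<omega> $ j))" for \<omega>
    by (simp add: S_def power2_eq_square sum_product mult.assoc mult.left_commute)
  have S2: "integrable M (\<lambda>\<omega>. (S \<omega>)\<^sup>2)"
    unfolding S2_eq by (simp add: m)
  have "expectation (\<lambda>\<omega>. (S \<omega>)\<^sup>2) = (\<Sum>i\<in>-{k}. \<Sum>j\<in>-{k}. c $ i * c $ j * (if i = j then 1 else 0))"
    unfolding S2_eq by (simp add: m)
  also have "\<dots> = (\<Sum>i\<in>-{k}. (c $ i)\<^sup>2)"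
    by (intro sum.cong) (auto simp: power2_eq_square if_distrib cong: if_cong)
  finally have ES2: "expectation (\<lambda>\<omega>. (S \<omega>)\<^sup>2) = (\<Sum>i\<in>-{k}. (c $ i)\<^sup>2)" .
  have "c \<bullet> v \<omega> = c $ k * v \<omega> $ k + S \<omega>" for \<omega>
    by (simp add: inner_vec_def S_def sum.remove[of UNIV k] Compl_eq_Diff_UNIV)
  then have "(c \<bullet> v \<omega>) * v \<omega> $ k - c $ k = c $ k * ((v \<omega> $ k)\<^sup>2 - 1) + v \<omega> $ k * S \<omega>" for \<omega>
    by (simp add: power2_eq_square algebra_simps)
  then show ?thesis
    using nn_integral_square_centred_indep[OF ind zero_mean_unit_variance_square[OF zmuv] S S2, of "c $ k"]
    by (simp add: ES2)
qed

text \<open>Only the first sum depends on the law of \<open>v\<close>. It is nonnegative, so this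
  exact formula yields both the lower bound and the case of equality.\<close>

lemma (in prob_space) mean_squared_deviation_cv:
  fixes v :: "'a \<Rightarrow> real^'n" and f fhat :: "real^'n \<Rightarrow> real" and \<theta> :: "real^'n"
  assumes adm: "admissible M v"
  defines "c \<equiv> grad f \<theta> - grad fhat \<theta>"
  shows "mean_squared_deviation M (cv_forward_gradient M v f fhat \<theta>) (grad f \<theta>) =
    (\<Sum>k\<in>UNIV. \<integral>\<^sup>+\<omega>. ennreal ((c $ k)\<^sup>2 * ((v \<omega> $ k)\<^sup>2 - 1)\<^sup>2) \<partial>M)
      + ennreal ((real CARD('n) - 1) * (norm c)\<^sup>2)"
proof -
  have [measurable]: "v \<in> borel_measurable M"
    using adm by (simp add: admissible_def)
  have [measurable]: "(\<lambda>\<omega>. v \<omega> $ k) \<in> borel_measurable M" for k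
    using adm by (auto simp: admissible_def zero_mean_unit_variance_def)
  have norm2: "(norm x)\<^sup>2 = (\<Sum>k\<in>UNIV. (x $ k)\<^sup>2)" for x :: "real^'n"
    by (simp add: norm_vec_def L2_set_def sum_nonneg)
  \<comment> \<open>By unbiasedness the constant summand is \<open>grad fhat \<theta>\<close>, so
    only the difference \<open>c\<close> of the gradients survives.\<close>
  have dev: "cv_forward_gradient M v f fhat \<theta> \<omega> - grad f \<theta> = (c \<bullet> v \<omega>) *\<^sub>R v \<omega> - c" for \<omega>
    by (simp add: cv_forward_gradient_def forward_gradient_unbiased(2)[OF adm])
       (simp add: forward_gradient_def c_def inner_diff_left scaleR_diff_left)
  \<comment> \<open>Each \<open>(c $ j)\<^sup>2\<close> is counted once for every \<open>k\<close>
    other than \<open>j\<close>, hence the factor d - 1.\<close>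
  have "(\<Sum>k\<in>UNIV. \<Sum>j\<in>-{k}. (c $ j)\<^sup>2) = (\<Sum>k\<in>UNIV. (norm c)\<^sup>2 - (c $ k)\<^sup>2)"
    by (simp add: norm2 Compl_eq_Diff_UNIV sum_diff1)
  also have "\<dots> = (real CARD('n) - 1) * (norm c)\<^sup>2"
    by (simp add: sum_subtractf norm2[of c, symmetric] algebra_simps)
  finally have off: "(\<Sum>k\<in>UNIV. \<Sum>j\<in>-{k}. (c $ j)\<^sup>2) = (real CARD('n) - 1) * (norm c)\<^sup>2" .
  have "mean_squared_deviation M (cv_forward_gradient M v f fhat \<theta>) (grad f \<theta>) =
      (\<integral>\<^sup>+\<omega>. (\<Sum>k\<in>UNIV. ennreal (((c \<bullet> v \<omega>) * v \<omega> $ k - c $ k)\<^sup>2)) \<partial>M)"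
    by (simp add: mean_squared_deviation_def dev norm2)
  also have "\<dots> = (\<Sum>k\<in>UNIV. \<integral>\<^sup>+\<omega>. ennreal (((c \<bullet> v \<omega>) * v \<omega> $ k - c $ k)\<^sup>2) \<partial>M)"
    by (rule nn_integral_sum) measurable
  also have "\<dots> = (\<Sum>k\<in>UNIV. \<integral>\<^sup>+\<omega>. ennreal ((c $ k)\<^sup>2 * ((v \<omega> $ k)\<^sup>2 - 1)\<^sup>2) \<partial>M)
      + (\<Sum>k\<in>UNIV. ennreal (\<Sum>j\<in>-{k}. (c $ j)\<^sup>2))"
    by (simp add: nn_integral_deviation_component[OF adm] sum.distrib)
  also have "(\<Sum>k\<in>UNIV. ennreal (\<Sum>j\<in>-{k}. (c $ j)\<^sup>2)) = ennreal ((real CARD('n) - 1) * (norm c)\<^sup>2)"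
    by (subst sum_ennreal) (simp_all add: sum_nonneg off)
  finally show ?thesis .
qed

text \<open>Two disjoint events of probability 1/2 exhaust the total mass.\<close>

lemma (in prob_space) rademacher_AE:
  assumes "rademacher M X"
  shows "AE \<omega> in M. X \<omega> = 1 \<or> X \<omega> = -1"
proof -
  have [measurable]: "X \<in> borel_measurable M"
    using assms by (simp add: rademacher_def)
  have "prob ({\<omega> \<in> space M. X \<omega> = 1} \<union> {\<omega> \<in> space M. X \<omega> = -1}) = 1"
    by (subst finite_measure_Union) (use assms in \<open>auto simp: rademacher_def\<close>)
  then have "AE \<omega> in M. \<omega> \<in> {\<omega> \<in> space M. X \<omega> = 1} \<union> {\<omega> \<in> space M. X \<omega> = -1}"
    by (subst (asm) prob_eq_1) simp_all
  then show ?thesis by eventually_elim auto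
qed

lemma (in prob_space) rademacher_zero_mean_unit_variance:
  assumes "rademacher M X"
  shows "zero_mean_unit_variance M X"
proof -
  have [measurable]: "X \<in> borel_measurable M"
    using assms by (simp add: rademacher_def)
  note AE = rademacher_AE[OF assms]
  have int: "integrable M X"
    by (rule integrable_const_bound[where B = 1]) (use AE in \<open>auto elim: eventually_mono\<close>)
  have int2: "integrable M (\<lambda>\<omega>. (X \<omega>)\<^sup>2)"
    by (rule integrable_const_bound[where B = 1]) (use AE in \<open>auto elim: eventually_mono\<close>)
  \<comment> \<open>Almost surely \<open>X\<close> is the difference of the indicators of its two
    values, which have equal probability.\<close>
  have "expectation X = expectation (\<lambda>\<omega>. indicator {\<omega> \<in> space M. X \<omega> = 1} \<omega> -
      indicator {\<omega> \<in> space M. X \<omega> = -1} \<omega>)"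
    by (rule integral_cong_AE) (use AE AE_space in \<open>auto elim!: eventually_elim2\<close>)
  also have "\<dots> = 0"
    by (subst Bochner_Integration.integral_diff) (use assms in \<open>simp_all add: rademacher_def integrable_indicator_iff less_top[symmetric]\<close>)
  finally have mean: "expectation X = 0" .
  have "expectation (\<lambda>\<omega>. (X \<omega>)\<^sup>2) = expectation (\<lambda>_. 1)"
    by (rule integral_cong_AE) (use AE in \<open>auto elim: eventually_mono\<close>)
  with int int2 mean show ?thesis
    by (simp add: zero_mean_unit_variance_def prob_space)
qed

text \<open>Competitors may live on a probability space other than \<open>M\<close>. Having
  \<open>admissible M v\<close> in the conclusion makes the minimum attained within the
  class.\<close>

theorem theorem3p4:
  fixes f fhat :: "real^'n \<Rightarrow> real"
    and \<theta> :: "real^'n"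
    and M :: "'a measure"
    and v :: "'a \<Rightarrow> real^'n"
  assumes "\<forall>x. f differentiable (at x)"
    and "\<forall>x. fhat differentiable (at x)"
    and "prob_space M"
    and "v \<in> borel_measurable M"
  shows "(admissible M v \<longrightarrow>
            integrable M (cv_forward_gradient M v f fhat \<theta>) \<and>
            prob_space.expectation M (cv_forward_gradient M v f fhat \<theta>) = grad f \<theta>) \<and>
         (indep_components M v \<and> (\<forall>i. rademacher M (\<lambda>\<omega>. v \<omega> $ i)) \<longrightarrow>
            admissible M v \<and>
            (\<forall>(N :: 'b measure) (w :: 'b \<Rightarrow> real^'n). prob_space N \<and> admissible N w \<longrightarrow>
               mean_squared_deviation M (cv_forward_gradient M v f fhat \<theta>) (grad f \<theta>)
                 \<le> mean_squared_deviation N (cv_forward_gradient N w f fhat \<theta>) (grad f \<theta>)) \<and>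
            mean_squared_deviation M (cv_forward_gradient M v f fhat \<theta>) (grad f \<theta>)
              = ennreal ((real CARD('n) - 1) * (norm (grad f \<theta> - grad fhat \<theta>))\<^sup>2))"
proof -
  interpret M: prob_space M by fact
  have min: "ennreal ((real CARD('n) - 1) * (norm (grad f \<theta> - grad fhat \<theta>))\<^sup>2)
      \<le> mean_squared_deviation N (cv_forward_gradient N w f fhat \<theta>) (grad f \<theta>)"
    if "prob_space N \<and> admissible N w" for N :: "'b measure" and w :: "'b \<Rightarrow> real^'n"
    using that by (simp add: prob_space.mean_squared_deviation_cv)
  have "admissible M v \<and>
      mean_squared_deviation M (cv_forward_gradient M v f fhat \<theta>) (grad f \<theta>)
        = ennreal ((real CARD('n) - 1) * (norm (grad f \<theta> - grad fhat \<theta>))\<^sup>2)"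
    if ind: "indep_components M v" and rad: "\<forall>i. rademacher M (\<lambda>\<omega>. v \<omega> $ i)"
  proof -
    have adm: "admissible M v"
      using assms(4) ind rad by (simp add: admissible_def M.rademacher_zero_mean_unit_variance)
    \<comment> \<open>Rademacher coordinates satisfy \<open>v_k^2 = 1\<close> almost surely, so the
      part depending on the law vanishes and the lower bound is reached.\<close>
    have "(\<integral>\<^sup>+\<omega>. ennreal (b * ((v \<omega> $ k)\<^sup>2 - 1)\<^sup>2) \<partial>M) = 0" for b k
    proof -
      have "AE \<omega> in M. ennreal (b * ((v \<omega> $ k)\<^sup>2 - 1)\<^sup>2) = 0"
        using M.rademacher_AE[OF rad[rule_format, of k]] by eventually_elim auto
      then show ?thesis by (simp cong: nn_integral_cong_AE)
    qed
    with adm show ?thesis by (simp add: M.mean_squared_deviation_cv)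
  qed
  with min show ?thesis
    using M.cv_forward_gradient_unbiased by auto
qed

end
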